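(* Let $f:\mathbb{R}^n\to\mathbb{R}$ be a smooth convex function with nonempty minimizer set $S$, let $x_0\in\mathbb{R}^n$, and let $(x_j)_{j\ge 0}$ be the sequence generated by the asynchronous stochastic coordinate descent iteration (defined in the context, unconstrained case) with steplength parameter $\gamma>0$ and delay bound $\tau$. For any $\rho>1$, define $$\psi := 1+ \frac{2 \tau \rho^{\tau} L_{\mathrm{res}}}{\sqrt{n}\, L_{\max}}.$$ Suppose that $\gamma>0$ satisfies the three upper bounds $$\gamma \le \frac{1}{\psi},\qquad \gamma \le \frac{(\rho-1) \sqrt{n}\, L_{\max}}{2 \rho^{\tau+1} L_{\mathrm{res}}},\qquad \gamma \le \frac{(\rho-1) \sqrt{n}\, L_{\max}}{L_{\mathrm{res}}\, \rho^{\tau} \left(2+\frac{L_{\mathrm{res}}}{\sqrt{n}\, L_{\max}}\right)}.$$ Then for any $j\ge 0$, $$\rho^{-1}\,\mathbb{E}\left(\|\nabla f(x_j)\|^2\right) \le \mathbb{E}\left(\|\nabla f(x_{j+1})\|^2\right)\le \rho\, \mathbb{E}\left(\|\nabla f(x_j)\|^2\right).$$ Moreover, if the essential strong convexity property (defined in the context) holds with parameter $l>0$, then $$\mathbb{E} (f(x_{j}) - f^* ) \le \left(1 - \frac{2l\gamma}{nL_{\max}} \left( 1-\frac{\psi}{2} \gamma \right)\right)^{j} (f(x_{0})-f^* ).$$ For general smooth convex $f$, assuming additionally that there is a real number $R$ such that $\|x_j-\mathcal{P}_S(x_j)\|\le R$ for all $j=0,1,2,\dots$, one has $$\mathbb{E}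 (f(x_j) - f^* ) \le \frac{1}{(f(x_{0}) -f^* )^{-1} + j \gamma \left(1-\frac{\psi}{2} \gamma\right) /(n L_{\max} R^2) }.$$
   Context: Notation: $\|\cdot\|$ is the Euclidean norm, $e_i$ the $i$th standard basis vector, $\nabla_i f(x)$ the $i$th component of $\nabla f(x)$. $S$ is the set of minimizers of $f$ over $\mathbb{R}^n$ (assumed nonempty), $f^*$ the optimal value, and $\mathcal{P}_S$ is Euclidean projection onto $S$. Lipschitz constants: $L_{\mathrm{res}}$ is the restricted Lipschitz constant of $\nabla f$: $\|\nabla f(x)-\nabla f(x+te_i)\|\le L_{\mathrm{res}}|t|$ for all $i=1,\dots,n$, $x\in\mathbb{R}^n$, $t\in\mathbb{R}$. $L_i$ is the coordinate Lipschitz constant of $\nabla f$ in the $i$th coordinate direction: $f(x+te_i)-f(x)\le \nabla_i f(x)\,t+\frac{L_i}{2}t^2$ for all $x,t$, or equivalently $|\nabla_i f(x)-\nabla_i f(x+te_i)|\le L_i|t|$. $L_{\max}:=\max_{i=1,\dots,n} L_i$. One has $L_{\mathrm{res}}\ge L_{\max}$. Essential strong convexity with parameter $l>0$: $f(x)-f(y)\ge\langle\nabla f(y),x-y\rangle+\frac{l}{2}\|x-y\|^2$ for all $x,y\in\mathbb{R}^n$ with $\mathcal{P}_S(x)=\mathcal{P}_S(y)$. Iteration (unconstrained case): several processors update a shared vector $x$ without synchronization; $x_j$ is the state of $x$ after $j$ updates. At each step $j=0,1,2,\dots$ an index $i(j)$ is chosen at random from $\{1,\dots,n\}$ with equal probability,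 and $$x_{j+1}=x_j-\frac{\gamma}{L_{\max}}\,e_{i(j)}\nabla_{i(j)}f(x_{k(j)}),$$ where $k(j)$ is the index of the iterate at which the update applied at step $j$ was calculated. It satisfies $k(j)\le j$, and the delay is assumed to be bounded uniformly by a positive integer $\tau$: $j-k(j)\le\tau$ for all $j$. The indices $i(j)$ are random variables, and $\mathbb{E}$ denotes expectation over all random variables. *)

theory Defs
  imports "HOL-Analysis.Analysis" "HOL-Probability.Probability"
begin

definition minimizers :: "('a \<Rightarrow> real) \<Rightarrow> 'a set" where
  "minimizers f = {x. \<forall>y. f x \<le> f y}"

definition optimal_value :: "('a \<Rightarrow> real) \<Rightarrow> real" where
  "optimal_value f = (INF x. f x)"

text \<open>
  Throughout, \<open>g\<close> stands for the gradient of \<open>f\<close>, and the standard basis vector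
  \<open>e\<^sub>i\<close> is \<open>axis i 1\<close>. The next two predicates say that a number is a valid constant;
  they do not ask for the least one.
\<close>

definition restricted_lipschitz_gradient :: "(real^'n \<Rightarrow> real^'n) \<Rightarrow> real \<Rightarrow> bool" where
  "restricted_lipschitz_gradient g Lres \<longleftrightarrow>
     (\<forall>i x t. norm (g x - g (x + t *\<^sub>R axis i 1)) \<le> Lres * \<bar>t\<bar>)"

definition coordinate_lipschitz_gradient ::
    "(real^'n \<Rightarrow> real) \<Rightarrow> (real^'n \<Rightarrow> real^'n) \<Rightarrow> 'n \<Rightarrow> real \<Rightarrow> bool" where
  "coordinate_lipschitz_gradient f g i Li \<longleftrightarrow>
     (\<forall>x t. f (x + t *\<^sub>R axis i 1) - f x \<le> (g x $ i) * t + Li / 2 * t\<^sup>2)"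

text \<open>
  For differentiable convex \<open>f\<close> with a minimizer, \<open>minimizers f\<close> is nonempty, closed and
  convex, so \<open>closest_point (minimizers f)\<close> is the Euclidean projection onto it.
\<close>

definition essentially_strongly_convex ::
    "(real^'n \<Rightarrow> real) \<Rightarrow> (real^'n \<Rightarrow> real^'n) \<Rightarrow> real \<Rightarrow> bool" where
  "essentially_strongly_convex f g l \<longleftrightarrow>
     (\<forall>x y. closest_point (minimizers f) x = closest_point (minimizers f) y \<longrightarrow>
        f x - f y \<ge> g y \<bullet> (x - y) + l / 2 * (norm (x - y))\<^sup>2)"

text \<open>
  One sample path: \<open>i j\<close> is the coordinate updated at step \<open>j\<close>, \<open>k j\<close> the index of the
  (possibly outdated) iterate at which that update was calculated, and \<open>s\<close> the steplength.
  If \<open>k j \<le> j\<close> for all \<open>j\<close>, these equations determine \<open>x\<close> uniquely.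
\<close>

definition async_scd_path ::
    "(real^'n \<Rightarrow> real^'n) \<Rightarrow> real \<Rightarrow> (nat \<Rightarrow> nat) \<Rightarrow> (nat \<Rightarrow> 'n) \<Rightarrow> real^'n
       \<Rightarrow> (nat \<Rightarrow> real^'n) \<Rightarrow> bool" where
  "async_scd_path g s k i x0 x \<longleftrightarrow>
     x 0 = x0 \<and> (\<forall>j. x (Suc j) = x j - (s * (g (x (k j)) $ i j)) *\<^sub>R axis (i j) 1)"

end

theory Submission
  imports Defs
begin

text \<open>
  Since \<open>i(j)\<close> is independent of the iterates up to \<open>x\<^sub>j\<close>, the squared length of step \<open>j\<close> is on
  average \<open>(\<gamma>/L\<^sub>m\<^sub>a\<^sub>x)\<^sup>2/n\<close> times the squared norm of the delayed gradient. Young's inequality turns this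
  into a bound of the change of the expected squared gradient norm \<open>G(j)\<close> in one step by \<open>G(j)\<close> and
  \<open>G(k(j))\<close>, so induction on \<open>j\<close> keeps consecutive ratios in \<open>[1/\<rho>, \<rho>]\<close>, and gradients at most \<open>\<tau>\<close>
  steps apart are comparable up to \<open>\<rho>\<^sup>\<tau>\<close>. The descent inequality then loses only the factor
  \<open>1 - \<psi>\<gamma>/2\<close> to the delay: the expected gap decreases by at least
  \<open>\<gamma>/(n L\<^sub>m\<^sub>a\<^sub>x) (1 - \<psi>\<gamma>/2) G(k(j))\<close>. The gradient here is the delayed one, but the gap is decreasing in
  expectation, so lower bounds of \<open>G(k(j))\<close> by the gap at \<open>k(j)\<close> are also bounds by the gap at \<open>j\<close>.
\<close>

section \<open>Convexity, gradients and the set of minimizers\<close>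

lemma GDERIV_along_line:
  assumes "GDERIV f x :> d"
  shows "((\<lambda>t. f (x + t *\<^sub>R v)) has_field_derivative d \<bullet> v) (at 0)"
proof -
  have "(f has_derivative (\<lambda>h. h \<bullet> d)) (at (x + 0 *\<^sub>R v))"
    using assms by (simp add: gderiv_def)
  then have "((\<lambda>t. f (x + t *\<^sub>R v)) has_derivative (\<lambda>t. (t *\<^sub>R v) \<bullet> d)) (at 0)"
    by (rule has_derivative_compose[rotated]) (auto intro!: derivative_eq_intros)
  then show ?thesis
    by (simp add: has_field_derivative_def inner_commute mult.commute mult_commute_abs)
qed

lemma convex_on_along_line:
  assumes "convex_on UNIV f"
  shows "convex_on UNIV (\<lambda>t::real. f (x + t *\<^sub>R v))"
proof (rule convex_onI)
  fix t a b :: real assume t: "0 < t" "t < 1"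
  have "x + ((1 - t) *\<^sub>R a + t *\<^sub>R b) *\<^sub>R v
      = (1 - t) *\<^sub>R (x + a *\<^sub>R v) + t *\<^sub>R (x + b *\<^sub>R v)"
    by (simp add: scaleR_add_left scaleR_diff_left scaleR_add_right)
  then show "f (x + ((1 - t) *\<^sub>R a + t *\<^sub>R b) *\<^sub>R v)
      \<le> (1 - t) * f (x + a *\<^sub>R v) + t * f (x + b *\<^sub>R v)"
    using convex_onD[OF assms, of t "x + a *\<^sub>R v" "x + b *\<^sub>R v"] t by (simp only: UNIV_I less_imp_le)
qed simp

text \<open>Restricting \<open>f\<close> to the line from \<open>x\<close> to \<open>y\<close>
  reduces this to the tangent inequality for convex functions of one real variable, taken between
  the parameters 0 and 1.\<close>

lemma convex_gradient_ineq:
  fixes f :: "'a::real_inner \<Rightarrow> real"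
  assumes "convex_on UNIV f" and "GDERIV f x :> d"
  shows "d \<bullet> (y - x) \<le> f y - f x"
  using convex_on_imp_above_tangent[OF convex_on_along_line[OF assms(1), of x "y - x"] _ _ _
      GDERIV_along_line[OF assms(2), of "y - x"], of 1]
  by simp

lemma optimal_value_eq:
  "p \<in> minimizers f \<Longrightarrow> optimal_value f = f p"
  unfolding minimizers_def optimal_value_def
  by (rule antisym[OF cINF_lower cINF_greatest]) (auto intro!: bdd_belowI2[where m = "f p"])

text \<open>Minimizers form an intersection of sublevel sets of a continuous function. Together with
  nonemptiness, closedness places \<open>closest_point\<close> inside the set.\<close>

lemma closed_minimizers:
  fixes f :: "'a::real_inner \<Rightarrow> real"
  assumes "\<And>x. GDERIV f x :> g x"
  shows "closed (minimizers f)"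
proof -
  have "continuous_on UNIV f"
    using assms unfolding gderiv_def
    by (intro continuous_at_imp_continuous_on ballI has_derivative_continuous)
  then have "closed {x. f x \<le> f y}" for y
    by (intro closed_Collect_le continuous_on_const)
  then have "closed (\<Inter>y. {x. f x \<le> f y})"
    by (intro closed_INT) auto
  moreover have "(\<Inter>y. {x. f x \<le> f y}) = minimizers f"
    by (auto simp: minimizers_def)
  ultimately show ?thesis by simp
qed

section \<open>Independent uniform indices and random variables determined by a finite
  history\<close>

locale uniform_indices = prob_space M
  for M :: "'a measure" +
  fixes I :: "nat \<Rightarrow> 'a \<Rightarrow> 'n::finite"
  assumes indep: "indep_vars (\<lambda>_. count_space UNIV) I UNIV"
    and uniform: "measure M {\<omega> \<in> space M. I j \<omega> = i} = 1 / real CARD('n)"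
begin

text \<open>Adaptedness to the history of indices. There are only finitely many histories of a given
  length, so it implies measurability and integrability.\<close>

definition determined :: "nat \<Rightarrow> ('a \<Rightarrow> 'b) \<Rightarrow> bool" where
  "determined j V \<longleftrightarrow>
     (\<forall>\<omega>\<in>space M. \<forall>\<omega>'\<in>space M. (\<forall>d<j. I d \<omega> = I d \<omega>') \<longrightarrow> V \<omega> = V \<omega>')"

lemma determinedI:
  "(\<And>\<omega> \<omega>'. \<omega> \<in> space M \<Longrightarrow> \<omega>' \<in> space M \<Longrightarrow> (\<And>d. d < j \<Longrightarrow> I d \<omega> = I d \<omega>') \<Longrightarrow> V \<omega> = V \<omega>')
    \<Longrightarrow> determined j V"
  unfolding determined_def by blast

lemma determinedD:
  assumes "determined j V" and "\<omega> \<in> space M" and "\<omega>' \<in> space M"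
    and "\<And>d. d < j \<Longrightarrow> I d \<omega> = I d \<omega>'"
  shows "V \<omega> = V \<omega>'"
  using assms unfolding determined_def by blast

lemma determined_mono: "determined i V \<Longrightarrow> i \<le> j \<Longrightarrow> determined j V"
  unfolding determined_def using less_le_trans by blast

lemma determined_compose2:
  assumes "determined j V" and "determined j W"
  shows "determined j (\<lambda>\<omega>. h (V \<omega>) (W \<omega>))"
proof (rule determinedI)
  fix \<omega> \<omega>'
  assume "\<omega> \<in> space M" "\<omega>' \<in> space M" "\<And>d. d < j \<Longrightarrow> I d \<omega> = I d \<omega>'"
  then have "V \<omega> = V \<omega>'" "W \<omega> = W \<omega>'"
    using assms unfolding determined_def by blast+
  then show "h (V \<omega>) (W \<omega>) = h (V \<omega>') (W \<omega>')"
    by simp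
qed

lemma determined_compose:
  "determined j V \<Longrightarrow> determined j (\<lambda>\<omega>. h (V \<omega>))"
  using determined_compose2[of j V V "\<lambda>v _. h v"] .

lemma determined_index: "i < j \<Longrightarrow> determined j (I i)"
  by (auto simp: determined_def)

text \<open>Independence speaks about functions of the index tuple, so \<open>V\<close> has to be
  written as one. \<open>H\<close> evaluates \<open>V\<close> at some sample point with the given
  history, and determinedness makes the choice immaterial.\<close>

lemma determined_factor:
  assumes "determined j V"
  obtains H where "\<And>\<omega>. \<omega> \<in> space M \<Longrightarrow> V \<omega> = H (\<lambda>d\<in>{..<j}. I d \<omega>)"
proof
  fix \<omega> assume \<omega>: "\<omega> \<in> space M"
  let ?r = "\<lambda>\<omega>. \<lambda>d\<in>{..<j}. I d \<omega>"
  let ?\<omega> = "SOME \<omega>'. \<omega>' \<in> space M \<and> ?r \<omega>' = ?r \<omega>"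
  have sel: "?\<omega> \<in> space M \<and> ?r ?\<omega> = ?r \<omega>"
    by (rule someI[of _ \<omega>]) (use \<omega> in simp)
  have "I d \<omega> = I d ?\<omega>" if "d < j" for d
    using fun_cong[OF conjunct2[OF sel], of d] that by simp
  then show "V \<omega> = (\<lambda>c. V (SOME \<omega>'. \<omega>' \<in> space M \<and> ?r \<omega>' = c)) (?r \<omega>)"
    using determinedD[OF assms \<omega>] sel by blast
qed

text \<open>The product sigma-algebra is discrete, so the arbitrary \<open>H\<close> obtained from
  \<open>determined_factor\<close> is measurable.\<close>

lemma PiM_history: "finite D \<Longrightarrow>
    PiM D (\<lambda>_. count_space (UNIV :: 'n set)) = count_space (PiE D (\<lambda>_. UNIV))"
  by (rule count_space_PiM_finite) (auto intro: countable_finite)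

lemma measurable_I [measurable]: "I j \<in> measurable M (count_space UNIV)"
  using indep by (auto simp: indep_vars_def)

lemma integrable_determined:
  fixes V :: "'a \<Rightarrow> real"
  assumes "determined j V"
  shows "integrable M V"
proof -
  obtain H where H: "\<And>\<omega>. \<omega> \<in> space M \<Longrightarrow> V \<omega> = H (\<lambda>d\<in>{..<j}. I d \<omega>)"
    using determined_factor[OF assms] by blast
  let ?C = "PiE {..<j} (\<lambda>_. UNIV :: 'n set)"
  have fin: "finite ?C" by (intro finite_PiE) auto
  have "(\<lambda>\<omega>. \<lambda>d\<in>{..<j}. I d \<omega>) \<in> measurable M (PiM {..<j} (\<lambda>_. count_space UNIV))"
    by measurable
  then have "(\<lambda>\<omega>. H (\<lambda>d\<in>{..<j}. I d \<omega>)) \<in> borel_measurable M"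
    by (rule measurable_compose) (simp add: PiM_history)
  then have "V \<in> borel_measurable M"
    by (subst measurable_cong[OF H])
  moreover have "norm (V \<omega>) \<le> Max ((\<lambda>c. \<bar>H c\<bar>) ` ?C)" if "\<omega> \<in> space M" for \<omega>
    using fin that by (auto simp: H intro!: Max_ge)
  ultimately show ?thesis
    by (intro integrable_const_bound[where B = "Max ((\<lambda>c. \<bar>H c\<bar>) ` ?C)"] AE_I2)
qed

text \<open>\<open>V\<close> is a function of the indices before \<open>j\<close>, hence independent
  of \<open>I j\<close>, and the expectation of the product factors.\<close>

lemma expectation_determined_indicator:
  fixes V :: "'a \<Rightarrow> real"
  assumes "determined j V"
  shows "expectation (\<lambda>\<omega>. V \<omega> * indicator {i} (I j \<omega>)) = expectation V / real CARD('n)"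
proof -
  obtain H where H: "\<And>\<omega>. \<omega> \<in> space M \<Longrightarrow> V \<omega> = H (\<lambda>d\<in>{..<j}. I d \<omega>)"
    using determined_factor[OF assms] by blast
  let ?V = "\<lambda>\<omega>. H (\<lambda>d\<in>{..<j}. I d \<omega>)"
  let ?J = "\<lambda>\<omega>. indicator {i} (I j \<omega>) :: real"
  have "indep_var borel (H \<circ> (\<lambda>\<omega>. \<lambda>d\<in>{..<j}. I d \<omega>))
          borel ((\<lambda>c. indicator {i} (c j)) \<circ> (\<lambda>\<omega>. \<lambda>d\<in>{j}. I d \<omega>))"
    by (rule indep_var_compose[OF indep_var_restrict[OF indep]]) (auto simp: PiM_history)
  then have indep': "indep_var borel ?V borel ?J"
    by (simp add: comp_def)
  have J: "determined (Suc j) ?J"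
    by (intro determined_compose[OF determined_index]) simp
  have V: "integrable M ?V"
    using integrable_determined[OF assms] by (simp add: H cong: Bochner_Integration.integrable_cong)
  have "expectation (\<lambda>\<omega>. V \<omega> * ?J \<omega>) = expectation (\<lambda>\<omega>. ?V \<omega> * ?J \<omega>)"
    by (intro Bochner_Integration.integral_cong) (simp_all add: H)
  also have "\<dots> = expectation ?V * expectation ?J"
    by (rule indep_var_lebesgue_integral[OF indep' V integrable_determined[OF J]])
  also have "expectation ?V = expectation V"
    by (intro Bochner_Integration.integral_cong) (simp_all add: H)
  also have "expectation ?J = expectation (indicator {\<omega> \<in> space M. I j \<omega> = i})"
    by (intro Bochner_Integration.integral_cong) (auto simp: indicator_def)
  also have "\<dots> = 1 / real CARD('n)"
    unfolding uniform[of j i, symmetric] by (simp add: Int_absorb2 subset_eq)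
  finally show ?thesis by simp
qed

text \<open>Split according to the value of \<open>I j\<close>. Letting \<open>V\<close> be
  function-valued keeps the coordinate open until index \<open>j\<close> is drawn.\<close>

lemma expectation_random_component:
  fixes V :: "'a \<Rightarrow> 'n \<Rightarrow> real"
  assumes "determined j V"
  shows "expectation (\<lambda>\<omega>. V \<omega> (I j \<omega>)) = expectation (\<lambda>\<omega>. \<Sum>i\<in>UNIV. V \<omega> i) / real CARD('n)"
proof -
  have V: "determined j (\<lambda>\<omega>. V \<omega> i)" for i
    using determined_compose[OF assms, of "\<lambda>v. v i"] .
  have J: "determined (Suc j) (\<lambda>\<omega>. V \<omega> i * indicator {i} (I j \<omega>))" for i
    by (intro determined_compose2[of _ _ _ "\<lambda>v k. v * indicator {i} k"]
        determined_mono[OF V] determined_index) auto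
  have "expectation (\<lambda>\<omega>. V \<omega> (I j \<omega>))
      = expectation (\<lambda>\<omega>. \<Sum>i\<in>UNIV. V \<omega> i * indicator {i} (I j \<omega>))"
    by (simp add: indicator_def)
  also have "\<dots> = (\<Sum>i\<in>UNIV. expectation (\<lambda>\<omega>. V \<omega> i * indicator {i} (I j \<omega>)))"
    using J by (intro Bochner_Integration.integral_sum integrable_determined)
  also have "\<dots> = (\<Sum>i\<in>UNIV. expectation (\<lambda>\<omega>. V \<omega> i)) / real CARD('n)"
    using V by (simp add: expectation_determined_indicator sum_divide_distrib)
  also have "(\<Sum>i\<in>UNIV. expectation (\<lambda>\<omega>. V \<omega> i)) = expectation (\<lambda>\<omega>. \<Sum>i\<in>UNIV. V \<omega> i)"
    by (rule Bochner_Integration.integral_sum[symmetric]) (use V integrable_determined in blast)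
  finally show ?thesis .
qed

end

section \<open>Two scalar recursions behind the linear and the sublinear rate\<close>

lemma power_contraction_bound:
  fixes e :: "nat \<Rightarrow> real"
  assumes nonneg: "\<And>j. e j \<ge> 0" and step: "\<And>j. e (Suc j) \<le> c * e j"
  shows "e j \<le> c ^ j * e 0"
proof (cases "c \<ge> 0")
  case True
  show ?thesis
  proof (induction j)
    case (Suc j)
    then show ?case
      using step[of j] mult_left_mono[OF Suc True] by (simp add: mult.assoc)
  qed simp
next
  case False
  \<comment> \<open>a negative rate is compatible with nonnegative values only if they all vanish\<close>
  have zero: "e j = 0" for j
  proof (rule ccontr)
    assume "e j \<noteq> 0"
    then have "c * e j < 0"
      using nonneg[of j] False by (intro mult_neg_pos) auto
    then show False
      using step[of j] nonneg[of "Suc j"] by simp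
  qed
  show ?thesis
    by (simp add: zero)
qed

text \<open>Dividing the recursion by \<open>e (Suc j) * e j\<close> shows that the reciprocals grow
  by at least \<open>c\<close> per step. Vanishing values are treated separately, because their
  reciprocal is 0 by convention.\<close>

lemma quadratic_decrease_bound:
  fixes e :: "nat \<Rightarrow> real"
  assumes nonneg: "\<And>j. e j \<ge> 0" and c: "c \<ge> 0"
    and step: "\<And>j. e (Suc j) \<le> e j - c * (e j)\<^sup>2"
  shows "e j \<le> 1 / (inverse (e 0) + real j * c)"
proof (induction j)
  case (Suc j)
  have den: "inverse (e 0) + real i * c \<ge> 0" for i
    using nonneg[of 0] c by simp
  show ?case
  proof (cases "e (Suc j) = 0")
    case True
    then show ?thesis using den[of "Suc j"] by simp
  next
    case False
    then have pos: "e (Suc j) > 0"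
      using nonneg[of "Suc j"] by simp
    have le: "e (Suc j) \<le> e j"
      using step[of j] c by (smt (verit) mult_nonneg_nonneg zero_le_power2)
    have "c * (e (Suc j) * e j) \<le> c * (e j)\<^sup>2"
      using le pos c by (intro mult_left_mono) (auto simp: power2_eq_square)
    then have "c * (e (Suc j) * e j) \<le> e j - e (Suc j)"
      using step[of j] by simp
    then have recip: "c \<le> inverse (e (Suc j)) - inverse (e j)"
      using pos le by (simp add: field_simps)
    \<comment> \<open>A zero denominator would make the quotient 0 by convention, and the induction
      hypothesis would then contradict \<open>e j > 0\<close>.\<close>
    have D: "inverse (e 0) + real j * c > 0"
    proof (rule ccontr)
      assume "\<not> ?thesis"
      then have "inverse (e 0) + real j * c = 0" using den[of j] by simp
      then show False using Suc pos le by simp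
    qed
    have "inverse (e 0) + real j * c \<le> inverse (e j)"
      using Suc D pos le by (simp add: field_simps)
    then have "inverse (e 0) + real (Suc j) * c \<le> inverse (e (Suc j))"
      using recip by (simp add: algebra_simps)
    moreover have "inverse (e 0) + real (Suc j) * c > 0"
      using D c by (simp add: algebra_simps)
    ultimately show ?thesis
      using pos by (simp add: field_simps)
  qed
qed (simp add: inverse_eq_divide)

text \<open>
  In terms of the paper, \<open>s\<close> is \<open>\<gamma>/L\<^sub>m\<^sub>a\<^sub>x\<close> and \<open>\<alpha>\<close> is \<open>\<gamma> L\<^sub>r\<^sub>e\<^sub>s/(sqrt n L\<^sub>m\<^sub>a\<^sub>x)\<close>. With \<open>\<gamma> \<le> 1\<close>, the assumptions
  \<open>alpha_lower\<close> and \<open>alpha_upper\<close> follow from the second and third bound on \<open>\<gamma>\<close>; the left-hand side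
  of \<open>delta_nonneg\<close> is \<open>1 - \<psi>\<gamma>/2\<close>.
\<close>

locale async_scd = uniform_indices M I
  for M :: "'a measure" and I :: "nat \<Rightarrow> 'a \<Rightarrow> 'n::finite" +
  fixes f :: "real^'n \<Rightarrow> real" and g :: "real^'n \<Rightarrow> real^'n"
    and Lres Lmax s \<rho> \<alpha> :: real and \<tau> :: nat and k :: "nat \<Rightarrow> nat"
    and x0 :: "real^'n" and X :: "nat \<Rightarrow> 'a \<Rightarrow> real^'n"
  assumes convex: "convex_on UNIV f"
    and gradient: "\<And>x. GDERIV f x :> g x"
    and minimizers_nonempty: "minimizers f \<noteq> {}"
    and res_lipschitz: "restricted_lipschitz_gradient g Lres"
    and coord_lipschitz: "\<And>i. coordinate_lipschitz_gradient f g i Lmax"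
    and k_le: "\<And>j. k j \<le> j"
    and delay_bound: "\<And>j. j - k j \<le> \<tau>"
    and iteration: "\<And>\<omega>. \<omega> \<in> space M \<Longrightarrow>
          async_scd_path g s k (\<lambda>j. I j \<omega>) x0 (\<lambda>j. X j \<omega>)"
    and s_pos: "s > 0"
    and rho: "\<rho> > 1"
    and alpha: "s * Lres = \<alpha> * sqrt (real CARD('n))"
    and alpha_nonneg: "\<alpha> \<ge> 0"
    and alpha_lower: "2 * \<alpha> * \<rho> ^ \<tau> * \<rho> \<le> \<rho> - 1"
    and alpha_upper: "\<alpha> * \<rho> ^ \<tau> * (2 + \<alpha>) \<le> \<rho> - 1"
    and delta_nonneg: "1 - Lmax * s / 2 - real \<tau> * \<rho> ^ \<tau> * \<alpha> \<ge> 0"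
begin

section \<open>The iterates as functions of the index history, and moments of a single step\<close>

definition grad_sq :: "nat \<Rightarrow> real" where
  "grad_sq j = expectation (\<lambda>\<omega>. (norm (g (X j \<omega>)))\<^sup>2)"

definition gap :: "nat \<Rightarrow> real" where
  "gap j = expectation (\<lambda>\<omega>. f (X j \<omega>) - optimal_value f)"

definition partial :: "nat \<Rightarrow> 'a \<Rightarrow> real" where
  "partial j \<omega> = g (X (k j) \<omega>) $ I j \<omega>"

lemma X_0: "\<omega> \<in> space M \<Longrightarrow> X 0 \<omega> = x0"
  using iteration by (simp add: async_scd_path_def)

lemma X_Suc: "\<omega> \<in> space M \<Longrightarrow> X (Suc j) \<omega> = X j \<omega> + (- s * partial j \<omega>) *\<^sub>R axis (I j \<omega>) 1"
  using iteration[of \<omega>] by (simp add: async_scd_path_def partial_def)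

text \<open>Step \<open>i\<close> reads \<open>X i\<close>, \<open>I i\<close> and the older iterate
  \<open>X (k i)\<close>; the last of these calls for strong induction.\<close>

lemma X_cong:
  assumes "\<omega> \<in> space M" "\<omega>' \<in> space M" and "\<And>d. d < j \<Longrightarrow> I d \<omega> = I d \<omega>'"
  shows "X j \<omega> = X j \<omega>'"
  using assms(3)
proof (induction j rule: less_induct)
  case (less j)
  show ?case
  proof (cases j)
    case 0
    then show ?thesis using assms by (simp add: X_0)
  next
    case (Suc i)
    have "X i \<omega> = X i \<omega>'" "X (k i) \<omega> = X (k i) \<omega>'"
      using Suc k_le[of i] by (auto intro!: less.IH less.prems)
    moreover have "I i \<omega> = I i \<omega>'" using Suc less.prems by simp
    ultimately show ?thesis
      using assms(1,2) by (simp only: Suc X_Suc partial_def)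
  qed
qed

lemma determined_X: "m \<le> j \<Longrightarrow> determined j (X m)"
  by (rule determined_mono[OF determinedI]) (rule X_cong)

lemma determined_partial: "d < j \<Longrightarrow> determined j (partial d)"
  unfolding partial_def using k_le[of d]
  by (intro determined_compose2[where h = "\<lambda>x i. g x $ i"] determined_X determined_index) auto

text \<open>An arbitrary \<open>h\<close> is allowed, since the integrand depends on finitely many
  indices and so takes finitely many values.\<close>

lemma integrable_path:
  fixes h :: "real^'n \<Rightarrow> real^'n \<Rightarrow> real \<Rightarrow> real"
  shows "integrable M (\<lambda>\<omega>. h (X p \<omega>) (X q \<omega>) (partial d \<omega>))"
proof -
  let ?j = "Suc (max d (max p q))"
  have "determined ?j (\<lambda>\<omega>. (X p \<omega>, X q \<omega>))"
    by (intro determined_compose2[where h = Pair] determined_X) auto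
  then have "determined ?j (\<lambda>\<omega>. (\<lambda>(x, y). h x y) (X p \<omega>, X q \<omega>) (partial d \<omega>))"
    by (intro determined_compose2[where h = "\<lambda>(x, y). h x y"] determined_partial) auto
  then show ?thesis
    by (intro integrable_determined) simp
qed

lemmas integrable_X = integrable_path[where h = "\<lambda>x _ _. h x" for h]
lemmas integrable_XX = integrable_path[where h = "\<lambda>x y _. h x y" for h]
lemmas integrable_X_partial = integrable_path[where h = "\<lambda>x _ u. h x u" for h]

text \<open>Both \<open>X p\<close> and \<open>X (k j)\<close> are fixed before \<open>I j\<close>
  is drawn, so averaging over the coordinate turns the product of components into an inner product
  divided by \<open>n\<close>.\<close>

lemma expectation_partial_mult:
  assumes "p \<le> j"
  shows "expectation (\<lambda>\<omega>. g (X p \<omega>) $ I j \<omega> * partial j \<omega>)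
       = expectation (\<lambda>\<omega>. g (X p \<omega>) \<bullet> g (X (k j) \<omega>)) / real CARD('n)"
proof -
  have "determined j (\<lambda>\<omega>. \<lambda>i. g (X p \<omega>) $ i * g (X (k j) \<omega>) $ i)"
    using assms k_le[of j]
    by (intro determined_compose2[where h = "\<lambda>x y i. g x $ i * g y $ i"] determined_X)
  from expectation_random_component[OF this] show ?thesis
    by (simp add: partial_def inner_vec_def)
qed

lemma expectation_partial_sq:
  "expectation (\<lambda>\<omega>. (partial j \<omega>)\<^sup>2) = grad_sq (k j) / real CARD('n)"
  using expectation_partial_mult[OF k_le[of j]]
  by (simp add: grad_sq_def partial_def power2_eq_square flip: power2_norm_eq_inner)

lemma grad_sq_nonneg: "grad_sq j \<ge> 0"
  by (simp add: grad_sq_def)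

text \<open>Young's inequality with weight \<open>sqrt n\<close>, which balances the factor \<open>1/n\<close> from the
  random choice of the coordinate.\<close>

lemma expectation_cross:
  "expectation (\<lambda>\<omega>. s * Lres * (norm (g (X p \<omega>)) * \<bar>partial d \<omega>\<bar>))
     \<le> \<alpha> / 2 * (grad_sq p + grad_sq (k d))"
proof -
  let ?n = "real CARD('n)"
  have "expectation (\<lambda>\<omega>. s * Lres * (norm (g (X p \<omega>)) * \<bar>partial d \<omega>\<bar>))
      \<le> expectation (\<lambda>\<omega>. \<alpha> / 2 * ((norm (g (X p \<omega>)))\<^sup>2 + ?n * (partial d \<omega>)\<^sup>2))"
  proof (rule integral_mono)
    show "integrable M (\<lambda>\<omega>. s * Lres * (norm (g (X p \<omega>)) * \<bar>partial d \<omega>\<bar>))"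
      by (rule integrable_X_partial)
    show "integrable M (\<lambda>\<omega>. \<alpha> / 2 * ((norm (g (X p \<omega>)))\<^sup>2 + ?n * (partial d \<omega>)\<^sup>2))"
      by (rule integrable_X_partial)
    fix \<omega>
    let ?a = "norm (g (X p \<omega>))" and ?b = "sqrt ?n * \<bar>partial d \<omega>\<bar>"
    have "s * Lres * (?a * \<bar>partial d \<omega>\<bar>) = \<alpha> / 2 * (2 * (?a * ?b))"
      unfolding alpha by simp
    also have "\<dots> \<le> \<alpha> / 2 * (?a\<^sup>2 + ?n * (partial d \<omega>)\<^sup>2)"
      using sum_squares_bound[of ?a ?b] alpha_nonneg
      by (intro mult_left_mono) (simp_all add: power_mult_distrib)
    finally show "s * Lres * (?a * \<bar>partial d \<omega>\<bar>) \<le> \<alpha> / 2 * (?a\<^sup>2 + ?n * (partial d \<omega>)\<^sup>2)" .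
  qed
  also have "\<dots> = \<alpha> / 2 * (expectation (\<lambda>\<omega>. (norm (g (X p \<omega>)))\<^sup>2)
      + ?n * expectation (\<lambda>\<omega>. (partial d \<omega>)\<^sup>2))"
    using integrable_X[of "\<lambda>x. (norm (g x))\<^sup>2" p] integrable_X_partial[of "\<lambda>_ u. u\<^sup>2" p d]
    by simp
  also have "\<dots> = \<alpha> / 2 * (grad_sq p + grad_sq (k d))"
    by (simp add: expectation_partial_sq flip: grad_sq_def)
  finally show ?thesis .
qed

section \<open>Comparison of expected squared gradient norms at nearby iterates\<close>

lemma gradient_step:
  assumes "\<omega> \<in> space M"
  shows "norm (g (X j \<omega>) - g (X (Suc j) \<omega>)) \<le> s * Lres * \<bar>partial j \<omega>\<bar>"
proof -
  have "norm (g (X j \<omega>) - g (X (Suc j) \<omega>)) \<le> Lres * \<bar>- s * partial j \<omega>\<bar>"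
    using res_lipschitz unfolding restricted_lipschitz_gradient_def X_Suc[OF assms] by blast
  then show ?thesis
    using s_pos by (simp add: abs_mult mult_ac)
qed

lemma gradient_steps:
  assumes "\<omega> \<in> space M" and "m \<le> j"
  shows "norm (g (X m \<omega>) - g (X j \<omega>)) \<le> (\<Sum>d = m..<j. s * Lres * \<bar>partial d \<omega>\<bar>)"
  using assms(2)
proof (induction j rule: dec_induct)
  case (step j)
  have "norm (g (X m \<omega>) - g (X (Suc j) \<omega>))
      \<le> norm (g (X m \<omega>) - g (X j \<omega>)) + norm (g (X j \<omega>) - g (X (Suc j) \<omega>))"
    using dist_triangle[of "g (X m \<omega>)" "g (X (Suc j) \<omega>)" "g (X j \<omega>)"] by (simp add: dist_norm)
  then show ?case
    using step gradient_step[OF assms(1), of j] by simp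
qed simp

text \<open>The change of the gradient is bounded by the step length, and
  \<open>expectation_cross\<close> bounds the decrease by
  \<open>\<alpha> * (grad_sq j + grad_sq (k j))\<close>. The delayed term is a hypothesis here so
  that an induction can supply it.\<close>

lemma grad_sq_lower_step:
  assumes "grad_sq (k j) \<le> \<rho> ^ \<tau> * grad_sq j"
  shows "grad_sq j \<le> \<rho> * grad_sq (Suc j)"
proof -
  have "grad_sq j - grad_sq (Suc j)
      = expectation (\<lambda>\<omega>. (norm (g (X j \<omega>)))\<^sup>2 - (norm (g (X (Suc j) \<omega>)))\<^sup>2)"
    unfolding grad_sq_def
    by (intro Bochner_Integration.integral_diff[symmetric] integrable_X)
  also have "\<dots> \<le> expectation (\<lambda>\<omega>. 2 * (s * Lres * (norm (g (X j \<omega>)) * \<bar>partial j \<omega>\<bar>)))"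
  proof (rule integral_mono)
    show "integrable M (\<lambda>\<omega>. (norm (g (X j \<omega>)))\<^sup>2 - (norm (g (X (Suc j) \<omega>)))\<^sup>2)"
      by (rule integrable_XX)
    show "integrable M (\<lambda>\<omega>. 2 * (s * Lres * (norm (g (X j \<omega>)) * \<bar>partial j \<omega>\<bar>)))"
      by (rule integrable_X_partial)
    fix \<omega> assume \<omega>: "\<omega> \<in> space M"
    let ?a = "g (X j \<omega>)" and ?b = "g (X (Suc j) \<omega>)"
    have "(norm ?a)\<^sup>2 - (norm ?b)\<^sup>2 = 2 * (?a \<bullet> (?a - ?b)) - (norm (?a - ?b))\<^sup>2"
      by (simp add: power2_norm_eq_inner algebra_simps inner_commute)
    also have "\<dots> \<le> 2 * (norm ?a * norm (?a - ?b))"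
      using norm_cauchy_schwarz[of ?a "?a - ?b"] by (smt (verit) zero_le_power2)
    also have "\<dots> \<le> 2 * (norm ?a * (s * Lres * \<bar>partial j \<omega>\<bar>))"
      using gradient_step[OF \<omega>, of j] by (intro mult_left_mono) auto
    finally show "(norm ?a)\<^sup>2 - (norm ?b)\<^sup>2 \<le> 2 * (s * Lres * (norm ?a * \<bar>partial j \<omega>\<bar>))"
      by (simp add: mult_ac)
  qed
  also have "\<dots> = 2 * expectation (\<lambda>\<omega>. s * Lres * (norm (g (X j \<omega>)) * \<bar>partial j \<omega>\<bar>))"
    by (rule integral_mult_right_zero)
  also have "\<dots> \<le> \<alpha> * (grad_sq j + grad_sq (k j))"
    using expectation_cross[of j j] by simp
  also have "\<dots> \<le> \<alpha> * (2 * \<rho> ^ \<tau> * grad_sq j)"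
  proof (rule mult_left_mono[OF _ alpha_nonneg])
    have "grad_sq j \<le> \<rho> ^ \<tau> * grad_sq j"
      using mult_right_mono[OF one_le_power[of \<rho> \<tau>] grad_sq_nonneg[of j]] rho by simp
    then show "grad_sq j + grad_sq (k j) \<le> 2 * \<rho> ^ \<tau> * grad_sq j"
      using assms by simp
  qed
  finally have "grad_sq j - grad_sq (Suc j) \<le> \<alpha> * (2 * \<rho> ^ \<tau> * grad_sq j)" .
  \<comment> \<open>The goal amounts to a relative decrease of at most
    \<open>1 - 1 / \<rho>\<close>; multiplied by \<open>\<rho>\<close>, this is what
    \<open>alpha_lower\<close> provides.\<close>
  then have "\<rho> * (grad_sq j - grad_sq (Suc j)) \<le> \<rho> * (\<alpha> * (2 * \<rho> ^ \<tau> * grad_sq j))"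
    using rho by (intro mult_left_mono) auto
  also have "\<dots> \<le> (\<rho> - 1) * grad_sq j"
    using mult_right_mono[OF alpha_lower grad_sq_nonneg[of j]] by (simp add: mult_ac)
  finally show ?thesis
    by (simp add: algebra_simps)
qed

text \<open>In this direction the squared difference enters with a plus sign. It contributes at most
  \<open>\<alpha>\<^sup>2 * grad_sq (k j)\<close>, which explains the factor
  \<open>2 + \<alpha>\<close> in \<open>alpha_upper\<close>.\<close>

lemma grad_sq_upper_step:
  assumes "grad_sq (k j) \<le> \<rho> ^ \<tau> * grad_sq j"
  shows "grad_sq (Suc j) \<le> \<rho> * grad_sq j"
proof -
  let ?n = "real CARD('n)"
  have "grad_sq (Suc j) - grad_sq j
      = expectation (\<lambda>\<omega>. (norm (g (X (Suc j) \<omega>)))\<^sup>2 - (norm (g (X j \<omega>)))\<^sup>2)"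
    unfolding grad_sq_def
    by (intro Bochner_Integration.integral_diff[symmetric] integrable_X)
  also have "\<dots> \<le> expectation (\<lambda>\<omega>. 2 * (s * Lres * (norm (g (X j \<omega>)) * \<bar>partial j \<omega>\<bar>))
      + \<alpha>\<^sup>2 * ?n * (partial j \<omega>)\<^sup>2)"
  proof (rule integral_mono)
    show "integrable M (\<lambda>\<omega>. (norm (g (X (Suc j) \<omega>)))\<^sup>2 - (norm (g (X j \<omega>)))\<^sup>2)"
      by (rule integrable_XX)
    show "integrable M (\<lambda>\<omega>. 2 * (s * Lres * (norm (g (X j \<omega>)) * \<bar>partial j \<omega>\<bar>))
        + \<alpha>\<^sup>2 * ?n * (partial j \<omega>)\<^sup>2)"
      by (rule integrable_X_partial)
    fix \<omega> assume \<omega>: "\<omega> \<in> space M"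
    let ?a = "g (X j \<omega>)" and ?b = "g (X (Suc j) \<omega>)"
    have step: "norm (?a - ?b) \<le> s * Lres * \<bar>partial j \<omega>\<bar>"
      by (rule gradient_step[OF \<omega>])
    have "(norm ?b)\<^sup>2 - (norm ?a)\<^sup>2 = 2 * (?a \<bullet> (?b - ?a)) + (norm (?a - ?b))\<^sup>2"
      by (simp add: power2_norm_eq_inner algebra_simps inner_commute)
    also have "\<dots> \<le> 2 * (norm ?a * norm (?a - ?b)) + (norm (?a - ?b))\<^sup>2"
      using norm_cauchy_schwarz[of ?a "?b - ?a"] by (simp add: norm_minus_commute)
    also have "\<dots> \<le> 2 * (norm ?a * (s * Lres * \<bar>partial j \<omega>\<bar>)) + (s * Lres * \<bar>partial j \<omega>\<bar>)\<^sup>2"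
      using step by (intro add_mono mult_left_mono power_mono) auto
    \<comment> \<open>The factor \<open>n\<close> produced here cancels against the
      \<open>1/n\<close> in \<open>expectation_partial_sq\<close>.\<close>
    also have "(s * Lres * \<bar>partial j \<omega>\<bar>)\<^sup>2 = \<alpha>\<^sup>2 * ?n * (partial j \<omega>)\<^sup>2"
      by (simp add: alpha power_mult_distrib)
    finally show "(norm ?b)\<^sup>2 - (norm ?a)\<^sup>2
        \<le> 2 * (s * Lres * (norm ?a * \<bar>partial j \<omega>\<bar>)) + \<alpha>\<^sup>2 * ?n * (partial j \<omega>)\<^sup>2"
      by (simp add: mult_ac)
  qed
  also have "\<dots> = expectation (\<lambda>\<omega>. 2 * (s * Lres * (norm (g (X j \<omega>)) * \<bar>partial j \<omega>\<bar>)))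
      + expectation (\<lambda>\<omega>. \<alpha>\<^sup>2 * ?n * (partial j \<omega>)\<^sup>2)"
    by (rule Bochner_Integration.integral_add) (rule integrable_X_partial)+
  also have "\<dots> = 2 * expectation (\<lambda>\<omega>. s * Lres * (norm (g (X j \<omega>)) * \<bar>partial j \<omega>\<bar>))
      + \<alpha>\<^sup>2 * grad_sq (k j)"
    by (simp only: integral_mult_right_zero expectation_partial_sq) simp
  also have "\<dots> \<le> \<alpha> * (grad_sq j + grad_sq (k j)) + \<alpha>\<^sup>2 * grad_sq (k j)"
    using expectation_cross[of j j] by simp
  also have "\<dots> \<le> \<alpha> * (2 * \<rho> ^ \<tau> * grad_sq j) + \<alpha>\<^sup>2 * (\<rho> ^ \<tau> * grad_sq j)"
  proof (intro add_mono mult_left_mono)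
    have "grad_sq j \<le> \<rho> ^ \<tau> * grad_sq j"
      using mult_right_mono[OF one_le_power[of \<rho> \<tau>] grad_sq_nonneg[of j]] rho by simp
    then show "grad_sq j + grad_sq (k j) \<le> 2 * \<rho> ^ \<tau> * grad_sq j"
      using assms by simp
  qed (use assms alpha_nonneg in auto)
  also have "\<dots> = \<alpha> * \<rho> ^ \<tau> * (2 + \<alpha>) * grad_sq j"
    by (simp add: power2_eq_square algebra_simps)
  also have "\<dots> \<le> (\<rho> - 1) * grad_sq j"
    by (rule mult_right_mono[OF alpha_upper grad_sq_nonneg])
  finally show ?thesis
    by (simp add: algebra_simps)
qed

text \<open>The ratio bound is assumed only for indices from \<open>m\<close> up to but excluding
  \<open>j\<close>, which makes the result usable while that bound is still being proved by
  induction.\<close>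

lemma grad_sq_le_power:
  assumes "\<And>i. m \<le> i \<Longrightarrow> i < j \<Longrightarrow> grad_sq i \<le> \<rho> * grad_sq (Suc i)" and "m \<le> j"
  shows "grad_sq m \<le> \<rho> ^ (j - m) * grad_sq j"
  using assms(2,1)
proof (induction j rule: dec_induct)
  case (step i)
  have "grad_sq m \<le> \<rho> ^ (i - m) * grad_sq i"
    using step by simp
  also have "\<dots> \<le> \<rho> ^ (i - m) * (\<rho> * grad_sq (Suc i))"
    using step rho by (intro mult_left_mono) auto
  finally show ?case
    using step by (simp add: Suc_diff_le mult_ac)
qed simp

lemma grad_sq_power_tau:
  assumes "\<And>i. m \<le> i \<Longrightarrow> i < j \<Longrightarrow> grad_sq i \<le> \<rho> * grad_sq (Suc i)"
    and "m \<le> j" and "j - m \<le> \<tau>"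
  shows "grad_sq m \<le> \<rho> ^ \<tau> * grad_sq j"
proof -
  have "grad_sq m \<le> \<rho> ^ (j - m) * grad_sq j"
    using assms by (intro grad_sq_le_power)
  also have "\<dots> \<le> \<rho> ^ \<tau> * grad_sq j"
    using rho assms(3) grad_sq_nonneg by (intro mult_right_mono power_increasing) auto
  finally show ?thesis .
qed

text \<open>Strong induction resolves the apparent circularity: step \<open>j\<close> needs
  \<open>grad_sq (k j)\<close> compared with \<open>grad_sq j\<close>, and this uses only ratios at
  indices below \<open>j\<close>.\<close>

lemma grad_sq_lower: "grad_sq j \<le> \<rho> * grad_sq (Suc j)"
proof (induction j rule: less_induct)
  case (less j)
  show ?case
    by (rule grad_sq_lower_step[OF grad_sq_power_tau]) (rule less k_le delay_bound, assumption?)+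
qed

lemma grad_sq_delayed: "m \<le> j \<Longrightarrow> j - m \<le> \<tau> \<Longrightarrow> grad_sq m \<le> \<rho> ^ \<tau> * grad_sq j"
  by (rule grad_sq_power_tau[OF grad_sq_lower])

lemma grad_sq_upper: "grad_sq (Suc j) \<le> \<rho> * grad_sq j"
  by (rule grad_sq_upper_step[OF grad_sq_delayed[OF k_le delay_bound]])

text \<open>Covers steps inside the delay window of \<open>j\<close> that read a later iterate than
  step \<open>j\<close> does.\<close>

lemma grad_sq_advanced:
  assumes "m \<le> j" and "j - m \<le> \<tau>"
  shows "grad_sq j \<le> \<rho> ^ \<tau> * grad_sq m"
proof -
  have "grad_sq j \<le> \<rho> ^ (j - m) * grad_sq m"
    using assms(1)
  proof (induction j rule: dec_induct)
    case (step i)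
    have "grad_sq (Suc i) \<le> \<rho> * grad_sq i"
      by (rule grad_sq_upper)
    also have "\<dots> \<le> \<rho> * (\<rho> ^ (i - m) * grad_sq m)"
      using step rho by (intro mult_left_mono) auto
    finally show ?case
      using step by (simp add: Suc_diff_le mult_ac)
  qed simp
  also have "\<dots> \<le> \<rho> ^ \<tau> * grad_sq m"
    using rho assms(2) grad_sq_nonneg by (intro mult_right_mono power_increasing) auto
  finally show ?thesis .
qed

section \<open>Expected descent of the optimality gap under delay\<close>

lemma expectation_gradient_inner:
  "expectation (\<lambda>\<omega>. g (X j \<omega>) \<bullet> g (X (k j) \<omega>))
     \<ge> (1 - real \<tau> * \<rho> ^ \<tau> * \<alpha>) * grad_sq (k j)"
proof -
  let ?b = "\<lambda>\<omega>. g (X (k j) \<omega>)"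
  let ?c = "\<lambda>d \<omega>. s * Lres * (norm (?b \<omega>) * \<bar>partial d \<omega>\<bar>)"
  have c: "integrable M (?c d)" for d
    by (rule integrable_X_partial)
  have tau: "1 \<le> \<rho> ^ \<tau>"
    using rho by simp
  have cross: "expectation (?c d) \<le> \<alpha> * \<rho> ^ \<tau> * grad_sq (k j)" if d: "d \<in> {k j..<j}" for d
  proof -
    \<comment> \<open>The iterate read at step \<open>d\<close> may lie on either side of
      \<open>k j\<close>. Since \<open>k d \<le> d < j\<close> and \<open>k j \<le> d\<close>, the
      distance is at most \<open>\<tau>\<close> in both cases.\<close>
    have delay: "k d - k j \<le> \<tau>" "k j - k d \<le> \<tau>"
      using d k_le[of d] delay_bound[of j] delay_bound[of d] by auto
    have "grad_sq (k d) \<le> \<rho> ^ \<tau> * grad_sq (k j)"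
    proof (cases "k d \<le> k j")
      case True
      then show ?thesis using delay by (intro grad_sq_delayed)
    next
      case False
      then show ?thesis using delay by (intro grad_sq_advanced) auto
    qed
    moreover have "grad_sq (k j) \<le> \<rho> ^ \<tau> * grad_sq (k j)"
      using mult_right_mono[OF tau grad_sq_nonneg[of "k j"]] by simp
    ultimately have "\<alpha> / 2 * (grad_sq (k j) + grad_sq (k d)) \<le> \<alpha> / 2 * (2 * (\<rho> ^ \<tau> * grad_sq (k j)))"
      using alpha_nonneg by (intro mult_left_mono) auto
    then show ?thesis
      using expectation_cross[of "k j" d] by simp
  qed
  \<comment> \<open>The inner product is the squared norm of the delayed gradient minus an error.
    That error splits over the at most \<open>\<tau>\<close> updates made since
    \<open>k j\<close>.\<close>
  have "grad_sq (k j) - (\<Sum>d = k j..<j. expectation (?c d))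
      = expectation (\<lambda>\<omega>. (norm (?b \<omega>))\<^sup>2 - (\<Sum>d = k j..<j. ?c d \<omega>))"
    using c integrable_X[of "\<lambda>x. (norm (g x))\<^sup>2" "k j"]
    by (simp only: grad_sq_def Bochner_Integration.integral_diff
        Bochner_Integration.integral_sum Bochner_Integration.integrable_sum)
  also have "\<dots> \<le> expectation (\<lambda>\<omega>. g (X j \<omega>) \<bullet> ?b \<omega>)"
  proof (rule integral_mono)
    show "integrable M (\<lambda>\<omega>. (norm (?b \<omega>))\<^sup>2 - (\<Sum>d = k j..<j. ?c d \<omega>))"
      using c integrable_X[of "\<lambda>x. (norm (g x))\<^sup>2" "k j"]
      by (intro Bochner_Integration.integrable_diff Bochner_Integration.integrable_sum)
    show "integrable M (\<lambda>\<omega>. g (X j \<omega>) \<bullet> ?b \<omega>)"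
      by (rule integrable_XX)
    fix \<omega> assume \<omega>: "\<omega> \<in> space M"
    have "?b \<omega> \<bullet> (?b \<omega> - g (X j \<omega>)) \<le> norm (?b \<omega>) * norm (?b \<omega> - g (X j \<omega>))"
      by (rule norm_cauchy_schwarz)
    also have "\<dots> \<le> norm (?b \<omega>) * (\<Sum>d = k j..<j. s * Lres * \<bar>partial d \<omega>\<bar>)"
      by (intro mult_left_mono gradient_steps[OF \<omega> k_le]) simp
    also have "\<dots> = (\<Sum>d = k j..<j. ?c d \<omega>)"
      by (simp add: sum_distrib_left mult_ac)
    finally show "(norm (?b \<omega>))\<^sup>2 - (\<Sum>d = k j..<j. ?c d \<omega>) \<le> g (X j \<omega>) \<bullet> ?b \<omega>"
      by (simp add: power2_norm_eq_inner inner_diff_right inner_commute)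
  qed
  finally have low: "grad_sq (k j) - (\<Sum>d = k j..<j. expectation (?c d))
      \<le> expectation (\<lambda>\<omega>. g (X j \<omega>) \<bullet> ?b \<omega>)" .
  have "(\<Sum>d = k j..<j. expectation (?c d)) \<le> real (j - k j) * (\<alpha> * \<rho> ^ \<tau> * grad_sq (k j))"
    using sum_bounded_above[OF cross, of "{k j..<j}" "\<lambda>d. d"] by (simp only: card_atLeastLessThan)
  also have "\<dots> \<le> real \<tau> * (\<alpha> * \<rho> ^ \<tau> * grad_sq (k j))"
    using delay_bound[of j] alpha_nonneg rho grad_sq_nonneg by (intro mult_right_mono) auto
  finally show ?thesis
    using low by (simp add: algebra_simps)
qed

text \<open>The share of the ideal descent that remains: one term is lost to the quadratic part of
  the coordinate bound, the other to the delay.\<close>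

definition \<delta> :: real where
  "\<delta> = 1 - Lmax * s / 2 - real \<tau> * \<rho> ^ \<tau> * \<alpha>"

text \<open>Average the coordinate descent inequality: its quadratic term has a known second moment,
  and its linear term is controlled by \<open>expectation_gradient_inner\<close>.\<close>

lemma gap_Suc: "gap (Suc j) \<le> gap j - s * \<delta> / real CARD('n) * grad_sq (k j)"
proof -
  let ?n = "real CARD('n)"
  let ?u = "\<lambda>\<omega>. g (X j \<omega>) $ I j \<omega> * partial j \<omega>" and ?v = "\<lambda>\<omega>. (partial j \<omega>)\<^sup>2"
  \<comment> \<open>Here \<open>I j\<close> also selects a component of
    \<open>g (X j \<omega>)\<close>, a form outside \<open>integrable_path\<close>.\<close>
  have u: "integrable M ?u"
  proof (rule integrable_determined)
    have "determined (Suc j) (\<lambda>\<omega>. g (X j \<omega>) $ I j \<omega>)"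
      by (intro determined_compose2[where h = "\<lambda>x i. g x $ i"] determined_X determined_index) auto
    then show "determined (Suc j) ?u"
      by (intro determined_compose2[where h = "(*)"] determined_partial) auto
  qed
  have v: "integrable M ?v"
    by (rule integrable_X_partial)
  have "gap (Suc j) - gap j
      = expectation (\<lambda>\<omega>. (f (X (Suc j) \<omega>) - optimal_value f) - (f (X j \<omega>) - optimal_value f))"
    unfolding gap_def by (intro Bochner_Integration.integral_diff[symmetric] integrable_X)
  also have "\<dots> \<le> expectation (\<lambda>\<omega>. Lmax / 2 * s\<^sup>2 * ?v \<omega> - s * ?u \<omega>)"
  proof (rule integral_mono)
    show "integrable M (\<lambda>\<omega>. (f (X (Suc j) \<omega>) - optimal_value f) - (f (X j \<omega>) - optimal_value f))"
      by (rule integrable_XX)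
    show "integrable M (\<lambda>\<omega>. Lmax / 2 * s\<^sup>2 * ?v \<omega> - s * ?u \<omega>)"
      using u v by simp
    fix \<omega> assume \<omega>: "\<omega> \<in> space M"
    have "f (X (Suc j) \<omega>) - f (X j \<omega>)
        \<le> g (X j \<omega>) $ I j \<omega> * (- s * partial j \<omega>) + Lmax / 2 * (- s * partial j \<omega>)\<^sup>2"
      using coord_lipschitz[of "I j \<omega>"]
      unfolding coordinate_lipschitz_gradient_def X_Suc[OF \<omega>] by blast
    then show "(f (X (Suc j) \<omega>) - optimal_value f) - (f (X j \<omega>) - optimal_value f)
        \<le> Lmax / 2 * s\<^sup>2 * ?v \<omega> - s * ?u \<omega>"
      by (simp add: power_mult_distrib mult_ac)
  qed
  also have "\<dots> = Lmax / 2 * s\<^sup>2 * expectation ?v - s * expectation ?u"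
    using u v by simp
  also have "\<dots> = Lmax / 2 * s\<^sup>2 * (grad_sq (k j) / ?n)
      - s / ?n * expectation (\<lambda>\<omega>. g (X j \<omega>) \<bullet> g (X (k j) \<omega>))"
    unfolding expectation_partial_sq expectation_partial_mult[OF order_refl] by simp
  also have "\<dots> \<le> Lmax / 2 * s\<^sup>2 * (grad_sq (k j) / ?n)
      - s / ?n * ((1 - real \<tau> * \<rho> ^ \<tau> * \<alpha>) * grad_sq (k j))"
    using expectation_gradient_inner[of j] s_pos by (intro diff_left_mono mult_left_mono) auto
  also have "\<dots> = - (s * \<delta> / ?n * grad_sq (k j))"
    by (simp add: \<delta>_def field_simps power2_eq_square)
  finally show ?thesis by simp
qed

lemma coefficient_nonneg: "s * \<delta> / real CARD('n) \<ge> 0"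
  using s_pos delta_nonneg by (simp add: \<delta>_def)

lemma gap_antimono: "m \<le> j \<Longrightarrow> gap j \<le> gap m"
proof (induction j rule: dec_induct)
  case (step j)
  have "0 \<le> s * \<delta> / real CARD('n) * grad_sq (k j)"
    by (intro mult_nonneg_nonneg coefficient_nonneg grad_sq_nonneg)
  then show ?case
    using gap_Suc[of j] step by simp
qed simp

section \<open>Lower bounds of the gradient by the gap, and the two convergence rates\<close>

lemma optimal_value_le: "optimal_value f \<le> f x"
  using minimizers_nonempty optimal_value_eq[of _ f] by (auto simp: minimizers_def)

lemma gap_nonneg: "gap j \<ge> 0"
  unfolding gap_def by (intro integral_nonneg_AE AE_I2) (simp add: optimal_value_le)

lemma gap_0: "gap 0 = f x0 - optimal_value f"
proof -
  have "gap 0 = expectation (\<lambda>_. f x0 - optimal_value f)"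
    unfolding gap_def by (intro Bochner_Integration.integral_cong) (simp_all add: X_0)
  then show ?thesis by (simp add: prob_space)
qed

lemma projection_in_minimizers: "closest_point (minimizers f) x \<in> minimizers f"
  by (rule closest_point_in_set[OF closed_minimizers[OF gradient] minimizers_nonempty])

text \<open>A point and its projection have the same projection, so essential strong convexity
  applies to the pair. Completing the square removes the displacement and leaves a
  Polyak-Lojasiewicz inequality.\<close>

lemma gap_le_grad_sq:
  assumes "l > 0" and esc: "essentially_strongly_convex f g l"
  shows "2 * l * gap m \<le> grad_sq m"
proof -
  have bound: "2 * l * (f x - optimal_value f) \<le> (norm (g x))\<^sup>2" for x
  proof -
    let ?p = "closest_point (minimizers f) x"
    have "closest_point (minimizers f) ?p = ?p"
      by (rule closest_point_self[OF projection_in_minimizers])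
    then have "f ?p - f x \<ge> g x \<bullet> (?p - x) + l / 2 * (norm (?p - x))\<^sup>2"
      using esc unfolding essentially_strongly_convex_def by blast
    moreover have "f ?p = optimal_value f"
      using optimal_value_eq[OF projection_in_minimizers] by simp
    moreover have "0 \<le> (norm (g x + l *\<^sub>R (?p - x)))\<^sup>2"
      by simp
    then have "0 \<le> (norm (g x))\<^sup>2 + 2 * l * (g x \<bullet> (?p - x)) + l\<^sup>2 * (norm (?p - x))\<^sup>2"
      unfolding power2_norm_eq_inner
      by (simp add: inner_add_left inner_add_right inner_commute power2_eq_square algebra_simps)
    ultimately have "2 * l * (f x - optimal_value f)
        \<le> 2 * l * (- (g x \<bullet> (?p - x)) - l / 2 * (norm (?p - x))\<^sup>2)"
      using assms(1) by (intro mult_left_mono) auto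
    also have "\<dots> \<le> (norm (g x))\<^sup>2"
      using \<open>0 \<le> (norm (g x))\<^sup>2 + _ + _\<close> by (simp add: algebra_simps power2_eq_square)
    finally show ?thesis .
  qed
  have "2 * l * gap m = expectation (\<lambda>\<omega>. 2 * l * (f (X m \<omega>) - optimal_value f))"
    unfolding gap_def by (rule integral_mult_right_zero[symmetric])
  also have "\<dots> \<le> grad_sq m"
    unfolding grad_sq_def by (rule integral_mono) (rule integrable_X bound)+
  finally show ?thesis .
qed

lemma linear_rate:
  assumes "l > 0" and "essentially_strongly_convex f g l"
  shows "gap j \<le> (1 - s * \<delta> / real CARD('n) * (2 * l)) ^ j * gap 0"
proof (rule power_contraction_bound[OF gap_nonneg])
  fix j
  have "2 * l * gap j \<le> 2 * l * gap (k j)"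
    using assms(1) gap_antimono[OF k_le[of j]] by simp
  also have "\<dots> \<le> grad_sq (k j)"
    by (rule gap_le_grad_sq[OF assms])
  finally have "s * \<delta> / real CARD('n) * (2 * l * gap j) \<le> s * \<delta> / real CARD('n) * grad_sq (k j)"
    by (rule mult_left_mono[OF _ coefficient_nonneg])
  then show "gap (Suc j) \<le> (1 - s * \<delta> / real CARD('n) * (2 * l)) * gap j"
    using gap_Suc[of j] by (simp add: algebra_simps)
qed

text \<open>Pointwise, convexity and Cauchy-Schwarz bound the gap by \<open>R\<close> times the
  gradient norm. Nonnegativity of the variance moves the square outside the expectation.\<close>

lemma gap_sq_le_grad_sq:
  assumes "AE \<omega> in M. \<forall>j. norm (X j \<omega> - closest_point (minimizers f) (X j \<omega>)) \<le> R"
  shows "(gap m)\<^sup>2 \<le> R\<^sup>2 * grad_sq m"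
proof -
  have "(gap m)\<^sup>2 \<le> expectation (\<lambda>\<omega>. (f (X m \<omega>) - optimal_value f)\<^sup>2)"
  proof -
    let ?V = "\<lambda>\<omega>. f (X m \<omega>) - optimal_value f"
    have "0 \<le> variance ?V"
      by (rule variance_positive)
    also have "\<dots> = expectation (\<lambda>\<omega>. (?V \<omega>)\<^sup>2) - (expectation ?V)\<^sup>2"
      by (intro variance_eq integrable_X)
    finally show ?thesis by (simp add: gap_def)
  qed
  also have "\<dots> \<le> expectation (\<lambda>\<omega>. R\<^sup>2 * (norm (g (X m \<omega>)))\<^sup>2)"
  proof (rule integral_mono_AE)
    show "AE \<omega> in M. (f (X m \<omega>) - optimal_value f)\<^sup>2 \<le> R\<^sup>2 * (norm (g (X m \<omega>)))\<^sup>2"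
      using assms
    proof (rule AE_mp, intro AE_I2 impI)
      fix \<omega> assume R: "\<forall>j. norm (X j \<omega> - closest_point (minimizers f) (X j \<omega>)) \<le> R"
      let ?x = "X m \<omega>"
      let ?p = "closest_point (minimizers f) ?x"
      have "f ?x - optimal_value f = - (f ?p - f ?x)"
        using optimal_value_eq[OF projection_in_minimizers] by simp
      also have "\<dots> \<le> g ?x \<bullet> (?x - ?p)"
        using convex_gradient_ineq[OF convex gradient, of ?x ?p] by (simp add: inner_diff_right)
      also have "\<dots> \<le> norm (g ?x) * norm (?x - ?p)"
        by (rule norm_cauchy_schwarz)
      also have "\<dots> \<le> norm (g ?x) * R"
        using R by (intro mult_left_mono) auto
      finally have "(f ?x - optimal_value f)\<^sup>2 \<le> (norm (g ?x) * R)\<^sup>2"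
        by (rule power_mono) (simp add: optimal_value_le)
      then show "(f ?x - optimal_value f)\<^sup>2 \<le> R\<^sup>2 * (norm (g ?x))\<^sup>2"
        by (simp add: power_mult_distrib mult.commute)
    qed
  qed (rule integrable_X)+
  also have "\<dots> = R\<^sup>2 * grad_sq m"
    unfolding grad_sq_def by (rule integral_mult_right_zero)
  finally show ?thesis .
qed

lemma sublinear_rate:
  assumes "AE \<omega> in M. \<forall>j. norm (X j \<omega> - closest_point (minimizers f) (X j \<omega>)) \<le> R"
  shows "gap j \<le> 1 / (inverse (gap 0) + real j * (s * \<delta> / (real CARD('n) * R\<^sup>2)))"
proof (rule quadratic_decrease_bound[OF gap_nonneg])
  let ?c = "s * \<delta> / (real CARD('n) * R\<^sup>2)"
  have c: "?c = s * \<delta> / real CARD('n) / R\<^sup>2"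
    by simp
  show "?c \<ge> 0"
    unfolding c by (intro divide_nonneg_nonneg coefficient_nonneg) simp
  fix j
  show "gap (Suc j) \<le> gap j - ?c * (gap j)\<^sup>2"
  \<comment> \<open>For \<open>R = 0\<close> division by zero makes \<open>?c\<close> vanish, and
    monotonicity of the gap suffices.\<close>
  proof (cases "R = 0")
    case True
    then show ?thesis using gap_antimono[of j "Suc j"] by simp
  next
    case False
    have "(gap j)\<^sup>2 \<le> (gap (k j))\<^sup>2"
      by (intro power_mono gap_antimono k_le gap_nonneg)
    also have "\<dots> \<le> R\<^sup>2 * grad_sq (k j)"
      by (rule gap_sq_le_grad_sq[OF assms])
    finally have "(gap j)\<^sup>2 / R\<^sup>2 \<le> grad_sq (k j)"
      using False by (simp add: field_simps)
    then have "s * \<delta> / real CARD('n) * ((gap j)\<^sup>2 / R\<^sup>2) \<le> s * \<delta> / real CARD('n) * grad_sq (k j)"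
      by (rule mult_left_mono[OF _ coefficient_nonneg])
    then show ?thesis
      using gap_Suc[of j] by simp
  qed
qed

end

section \<open>Translation of the original constants and steplength bounds\<close>

theorem theorem1:
  fixes f :: "real^'n \<Rightarrow> real" and g :: "real^'n \<Rightarrow> real^'n"
    and Lres Lmax \<gamma> \<rho> \<psi> n :: real and L :: "'n \<Rightarrow> real"
    and \<tau> :: nat and k :: "nat \<Rightarrow> nat"
    and M :: "'a measure" and I :: "nat \<Rightarrow> 'a \<Rightarrow> 'n"
    and x0 :: "real^'n" and X :: "nat \<Rightarrow> 'a \<Rightarrow> real^'n"
  assumes n: "n = real CARD('n)"
    and convex: "convex_on UNIV f"
    and gradient: "\<And>x. GDERIV f x :> g x"
    and minimizers_nonempty: "minimizers f \<noteq> {}"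
    and Lres: "restricted_lipschitz_gradient g Lres"
    and L: "\<And>i. coordinate_lipschitz_gradient f g i (L i)"
    and Lmax: "Lmax = Max (range L)"
    and tau_pos: "\<tau> \<ge> 1"
    and k_le: "\<And>j. k j \<le> j"
    and delay_bound: "\<And>j. j - k j \<le> \<tau>"
    and prob_space: "prob_space M"
    and indices_indep: "prob_space.indep_vars M (\<lambda>_. count_space UNIV) I UNIV"
    and indices_uniform: "\<And>j i. measure M {\<omega> \<in> space M. I j \<omega> = i} = 1 / n"
    and iteration: "\<And>\<omega>. \<omega> \<in> space M \<Longrightarrow>
          async_scd_path g (\<gamma> / Lmax) k (\<lambda>j. I j \<omega>) x0 (\<lambda>j. X j \<omega>)"
    and rho: "\<rho> > 1"
    and psi: "\<psi> = 1 + 2 * real \<tau> * \<rho> ^ \<tau> * Lres / (sqrt n * Lmax)"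
    and gamma_pos: "\<gamma> > 0"
    and gamma_le_1: "\<gamma> \<le> 1 / \<psi>"
    and gamma_le_2: "\<gamma> \<le> (\<rho> - 1) * sqrt n * Lmax / (2 * \<rho> ^ (\<tau> + 1) * Lres)"
    and gamma_le_3: "\<gamma> \<le> (\<rho> - 1) * sqrt n * Lmax /
                        (Lres * \<rho> ^ \<tau> * (2 + Lres / (sqrt n * Lmax)))"
  shows "(\<forall>j. inverse \<rho> * (\<integral>\<omega>. (norm (g (X j \<omega>)))\<^sup>2 \<partial>M)
                 \<le> (\<integral>\<omega>. (norm (g (X (j + 1) \<omega>)))\<^sup>2 \<partial>M)
             \<and> (\<integral>\<omega>. (norm (g (X (j + 1) \<omega>)))\<^sup>2 \<partial>M)
                 \<le> \<rho> * (\<integral>\<omega>. (norm (g (X j \<omega>)))\<^sup>2 \<partial>M))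
    \<and> (\<forall>l>0. essentially_strongly_convex f g l \<longrightarrow>
          (\<forall>j. (\<integral>\<omega>. (f (X j \<omega>) - optimal_value f) \<partial>M)
             \<le> (1 - 2 * l * \<gamma> / (n * Lmax) * (1 - \<psi> / 2 * \<gamma>)) ^ j * (f x0 - optimal_value f)))
    \<and> (\<forall>R. (AE \<omega> in M. \<forall>j. norm (X j \<omega> - closest_point (minimizers f) (X j \<omega>)) \<le> R) \<longrightarrow>
          (\<forall>j. (\<integral>\<omega>. (f (X j \<omega>) - optimal_value f) \<partial>M)
             \<le> 1 / (inverse (f x0 - optimal_value f)
                    + real j * \<gamma> * (1 - \<psi> / 2 * \<gamma>) / (n * Lmax * R\<^sup>2))))"
proof -
  interpret P: prob_space M by (fact prob_space)
  \<comment> \<open>With this ratio, \<open>\<psi>\<close> becomes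
    \<open>1 + 2 * \<tau> * \<rho> ^ \<tau> * q\<close>, and \<open>\<alpha>\<close> is instantiated
    by \<open>\<gamma> * q\<close>.\<close>
  define q where "q = Lres / (sqrt n * Lmax)"
  have n_pos: "n > 0" by (simp add: n)
  have "0 \<le> norm (g 0 - g (0 + 1 *\<^sub>R axis undefined 1))"
    by simp
  also have "\<dots> \<le> Lres * \<bar>1\<bar>"
    using Lres unfolding restricted_lipschitz_gradient_def by blast
  finally have Lres_nonneg: "Lres \<ge> 0" by simp
  \<comment> \<open>Positivity of both Lipschitz constants is extracted from this bound: with
    \<open>Lres = 0\<close> its right-hand side would be 0 by convention, and then the sign of the
    quotient decides that of \<open>Lmax\<close>.\<close>
  have bound_pos: "(\<rho> - 1) * sqrt n * Lmax / (2 * \<rho> ^ (\<tau> + 1) * Lres) > 0"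
    using gamma_le_2 gamma_pos by simp
  then have "Lres \<noteq> 0" by auto
  then have Lres_pos: "Lres > 0"
    using Lres_nonneg by simp
  have "0 * (2 * \<rho> ^ (\<tau> + 1) * Lres) < (\<rho> - 1) * sqrt n * Lmax"
    using bound_pos Lres_pos rho by (subst (asm) pos_less_divide_eq) auto
  moreover have "(\<rho> - 1) * sqrt n > 0"
    using rho n_pos by simp
  ultimately have Lmax_pos: "Lmax > 0"
    using zero_less_mult_pos[of "(\<rho> - 1) * sqrt n" Lmax] by simp
  have q_pos: "q > 0"
    using Lres_pos Lmax_pos n_pos by (simp add: q_def)
  have psi_eq: "\<psi> = 1 + 2 * real \<tau> * \<rho> ^ \<tau> * q"
    by (simp add: psi q_def)
  then have psi_ge_1: "\<psi> \<ge> 1"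
    using q_pos rho by simp
  then have gamma_psi: "\<psi> * \<gamma> \<le> 1"
    using gamma_le_1 by (simp add: field_simps)
  have gamma_1: "\<gamma> \<le> 1"
    using gamma_psi order_trans[OF mult_right_mono[OF psi_ge_1, of \<gamma>]] gamma_pos by simp
  have delta: "1 - \<psi> / 2 * \<gamma> = 1 - Lmax * (\<gamma> / Lmax) / 2 - real \<tau> * \<rho> ^ \<tau> * (\<gamma> * q)"
    using Lmax_pos by (simp add: psi_eq field_simps)

  interpret async_scd M I f g Lres Lmax "\<gamma> / Lmax" \<rho> "\<gamma> * q" \<tau> k x0 X
  proof
    show "P.indep_vars (\<lambda>_. count_space UNIV) I UNIV" by (fact indices_indep)
    show "measure M {\<omega> \<in> space M. I j \<omega> = i} = 1 / real CARD('n)" for j i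
      using indices_uniform by (simp add: n)
    show "convex_on UNIV f" by (fact convex)
    show "GDERIV f x :> g x" for x by (fact gradient)
    show "minimizers f \<noteq> {}" by (fact minimizers_nonempty)
    show "restricted_lipschitz_gradient g Lres" by (fact Lres)
    show "coordinate_lipschitz_gradient f g i Lmax" for i
      unfolding coordinate_lipschitz_gradient_def
    proof (intro allI)
      fix x t
      have "L i / 2 * t\<^sup>2 \<le> Lmax / 2 * t\<^sup>2"
        unfolding Lmax by (intro mult_right_mono divide_right_mono Max_ge) auto
      then show "f (x + t *\<^sub>R axis i 1) - f x \<le> g x $ i * t + Lmax / 2 * t\<^sup>2"
        using L[of i, unfolded coordinate_lipschitz_gradient_def, rule_format, of x t] by linarith
    qed
    show "k j \<le> j" for j by (fact k_le)
    show "j - k j \<le> \<tau>" for j by (fact delay_bound)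
    show "async_scd_path g (\<gamma> / Lmax) k (\<lambda>j. I j \<omega>) x0 (\<lambda>j. X j \<omega>)" if "\<omega> \<in> space M" for \<omega>
      using that by (rule iteration)
    show "\<gamma> / Lmax > 0" using gamma_pos Lmax_pos by simp
    show "\<rho> > 1" by (fact rho)
    show "\<gamma> / Lmax * Lres = \<gamma> * q * sqrt (real CARD('n))"
      using n_pos by (simp add: q_def n)
    show "\<gamma> * q \<ge> 0" using gamma_pos q_pos by simp
    have "\<gamma> * (2 * \<rho> ^ (\<tau> + 1) * Lres) \<le> (\<rho> - 1) * sqrt n * Lmax"
      using gamma_le_2 rho Lres_pos by (subst (asm) pos_le_divide_eq) auto
    then show "2 * (\<gamma> * q) * \<rho> ^ \<tau> * \<rho> \<le> \<rho> - 1"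
      using Lmax_pos n_pos by (simp add: q_def field_simps)
    have "\<gamma> * (Lres * \<rho> ^ \<tau> * (2 + q)) \<le> (\<rho> - 1) * sqrt n * Lmax"
      using gamma_le_3 rho Lres_pos q_pos unfolding q_def[symmetric]
      by (subst (asm) pos_le_divide_eq) auto
    then have "\<gamma> * q * \<rho> ^ \<tau> * (2 + q) \<le> \<rho> - 1"
      using Lmax_pos n_pos by (simp add: q_def field_simps)
    \<comment> \<open>The third steplength bound contains \<open>2 + q\<close>; since
      \<open>\<gamma> \<le> 1\<close>, it implies the version with
      \<open>2 + \<gamma> * q\<close>.\<close>
    moreover have "\<gamma> * q * \<rho> ^ \<tau> * (2 + \<gamma> * q) \<le> \<gamma> * q * \<rho> ^ \<tau> * (2 + q)"
      using gamma_1 gamma_pos q_pos rho by (intro mult_left_mono) auto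
    ultimately show "\<gamma> * q * \<rho> ^ \<tau> * (2 + \<gamma> * q) \<le> \<rho> - 1"
      by linarith
    show "1 - Lmax * (\<gamma> / Lmax) / 2 - real \<tau> * \<rho> ^ \<tau> * (\<gamma> * q) \<ge> 0"
      unfolding delta[symmetric] using gamma_psi by simp
  qed

  have delta_eq: "\<delta> = 1 - \<psi> / 2 * \<gamma>"
    unfolding \<delta>_def delta ..
  show ?thesis
  proof (intro conjI allI impI, goal_cases)
    case (1 j)
    then show ?case
      using grad_sq_lower[of j] rho by (simp add: grad_sq_def field_simps)
  next
    case (2 j)
    then show ?case
      using grad_sq_upper[of j] by (simp add: grad_sq_def)
  next
    case (3 l j)
    have coefficient: "2 * l * \<gamma> / (n * Lmax) * (1 - \<psi> / 2 * \<gamma>)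
        = \<gamma> / Lmax * \<delta> / real CARD('n) * (2 * l)"
      by (simp add: delta_eq n mult_ac)
    show ?case
      unfolding coefficient gap_0[symmetric] gap_def[symmetric] by (rule linear_rate[OF 3])
  next
    case (4 R j)
    have coefficient: "real j * \<gamma> * (1 - \<psi> / 2 * \<gamma>) / (n * Lmax * R\<^sup>2)
        = real j * (\<gamma> / Lmax * \<delta> / (real CARD('n) * R\<^sup>2))"
      by (simp add: delta_eq n mult_ac)
    show ?case
      unfolding coefficient gap_0[symmetric] gap_def[symmetric] by (rule sublinear_rate[OF 4])
  qed
qed

end
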